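(* Let $B=\{\mathbf b_1,\ldots,\mathbf b_p\}\subset\mathbb{C}^k\setminus\{0\}$ be a set which spans $\mathbb{C}^k$, with $\mathbf{b}_i=(b_i^1,\dots,b_i^k)$. Let $r_0,\ldots,r_p$ be nonnegative integers with $r_j>0$ for each $j\geq1$, and set $r=r_0+\cdots+r_p$. Then there is a solvable complex Lie algebra $\mathfrak{s}$ with abelian nilradical $\mathfrak n$, with $\dim\mathfrak{n}=r$ and $\dim(\mathfrak s/\mathfrak n)=k$, for which (with respect to a suitable basis of $\mathfrak{s}$ whose first $r$ elements form a basis of $\mathfrak{n}$) \[ Q_{\mathfrak s}(z_0,z_1,\ldots,z_{r+k})=z_0^{k+r_0}\prod_{i=1}^p\left(z_0+\sum_{\alpha=1}^k b_i^\alpha z_{r+\alpha}\right)^{r_i}. \]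
   Context: The nilradical is the unique maximal nilpotent ideal. For a basis $y_1,\dots,y_{r+k}$ of $\mathfrak{s}$, the characteristic polynomial is $Q_{\mathfrak{s}}(z_0,z_1,\dots,z_{r+k})=\det\bigl(z_0I+\sum_{i=1}^{r+k}z_i\operatorname{ad}y_i\bigr)$. In the convention used here $y_1,\dots,y_r$ is a basis of $\mathfrak{n}$ and $y_{r+1},\dots,y_{r+k}$ is a basis of a vector-space complement. *)

theory Defs
  imports "Jordan_Normal_Form.VS_Connect" "HOL-Algebra.AbelCoset" "HOL-Library.Poly_Mapping"
begin

section \<open>Lie algebras\<close>

record ('a, 'b) lie_algebra = "('a, 'b) module" +
  bracket :: "['b, 'b] \<Rightarrow> 'b" (\<open>\<lblot>_,_\<rblot>\<index>\<close>)

text \<open>As for modules, the ring fields \<open>mult\<close> and \<open>one\<close> of the record play no role.\<close>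

locale lie_algebra = vectorspace K L for K :: "('a, 'd) ring_scheme"
    and L :: "('a, 'b, 'c) lie_algebra_scheme" (structure) +
  assumes bracket_closed:
      "\<lbrakk>x \<in> carrier L; y \<in> carrier L\<rbrakk> \<Longrightarrow> \<lblot>x, y\<rblot> \<in> carrier L"
    and bracket_add_left:
      "\<lbrakk>x \<in> carrier L; y \<in> carrier L; z \<in> carrier L\<rbrakk> \<Longrightarrow> \<lblot>x \<oplus> y, z\<rblot> = \<lblot>x, z\<rblot> \<oplus> \<lblot>y, z\<rblot>"
    and bracket_add_right:
      "\<lbrakk>x \<in> carrier L; y \<in> carrier L; z \<in> carrier L\<rbrakk> \<Longrightarrow> \<lblot>x, y \<oplus> z\<rblot> = \<lblot>x, y\<rblot> \<oplus> \<lblot>x, z\<rblot>"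
    and bracket_smult_left:
      "\<lbrakk>c \<in> carrier K; x \<in> carrier L; y \<in> carrier L\<rbrakk> \<Longrightarrow> \<lblot>c \<odot> x, y\<rblot> = c \<odot> \<lblot>x, y\<rblot>"
    and bracket_smult_right:
      "\<lbrakk>c \<in> carrier K; x \<in> carrier L; y \<in> carrier L\<rbrakk> \<Longrightarrow> \<lblot>x, c \<odot> y\<rblot> = c \<odot> \<lblot>x, y\<rblot>"
    and bracket_self: "x \<in> carrier L \<Longrightarrow> \<lblot>x, x\<rblot> = \<zero>"
    and jacobi:
      "\<lbrakk>x \<in> carrier L; y \<in> carrier L; z \<in> carrier L\<rbrakk> \<Longrightarrow>
        \<lblot>x, \<lblot>y, z\<rblot>\<rblot> \<oplus> \<lblot>y, \<lblot>z, x\<rblot>\<rblot> \<oplus> \<lblot>z, \<lblot>x, y\<rblot>\<rblot> = \<zero>"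
begin

definition ad :: "'b \<Rightarrow> 'b \<Rightarrow> 'b"
  where "ad x = (\<lambda>v. \<lblot>x, v\<rblot>)"

definition bracket_span :: "'b set \<Rightarrow> 'b set \<Rightarrow> 'b set"
  where "bracket_span A B = span {\<lblot>x, y\<rblot> | x y. x \<in> A \<and> y \<in> B}"

primrec derived_series :: "nat \<Rightarrow> 'b set"
  where
    "derived_series 0 = carrier L"
  | "derived_series (Suc n) = bracket_span (derived_series n) (derived_series n)"

definition solvable :: bool
  where "solvable \<longleftrightarrow> (\<exists>n. derived_series n = {\<zero>})"

definition lie_ideal :: "'b set \<Rightarrow> bool"
  where "lie_ideal I \<longleftrightarrow> subspace K I L \<and> (\<forall>x\<in>carrier L. \<forall>y\<in>I. \<lblot>x, y\<rblot> \<in> I)"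

text \<open>The lower central series of \<open>I\<close> as a Lie algebra in its own right:
  only brackets with elements of \<open>I\<close>, not of the ambient algebra, are taken.\<close>

primrec lower_central_series :: "'b set \<Rightarrow> nat \<Rightarrow> 'b set"
  where
    "lower_central_series I 0 = I"
  | "lower_central_series I (Suc n) = bracket_span I (lower_central_series I n)"

definition nilpotent_ideal :: "'b set \<Rightarrow> bool"
  where "nilpotent_ideal I \<longleftrightarrow> lie_ideal I \<and> (\<exists>n. lower_central_series I n = {\<zero>})"

definition is_nilradical :: "'b set \<Rightarrow> bool"
  where "is_nilradical N \<longleftrightarrow>
    maximal N nilpotent_ideal \<and> (\<forall>M. maximal M nilpotent_ideal \<longrightarrow> M = N)"

definition abelian_on :: "'b set \<Rightarrow> bool"
  where "abelian_on A \<longleftrightarrow> (\<forall>x\<in>A. \<forall>y\<in>A. \<lblot>x, y\<rblot> = \<zero>)"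

text \<open>The coordinates of \<open>v\<close> with respect to a finite basis \<open>Y\<close>, as a function on \<open>Y\<close>.\<close>

definition coords :: "'b set \<Rightarrow> 'b \<Rightarrow> 'b \<Rightarrow> 'a"
  where "coords Y v = (THE a. a \<in> Y \<rightarrow>\<^sub>E carrier K \<and> lincomb a Y = v)"

text \<open>The matrix of \<open>T\<close> with respect to the ordered basis \<open>y 1, \<dots>, y n\<close>.
  Basis vectors are counted from 1, matrix rows and columns from 0.\<close>

definition matrix_of :: "nat \<Rightarrow> (nat \<Rightarrow> 'b) \<Rightarrow> ('b \<Rightarrow> 'b) \<Rightarrow> 'a mat"
  where "matrix_of n y T =
    mat n n (\<lambda>(i, j). coords (y ` {1..n}) (T (y (Suc j))) (y (Suc i)))"

end

section \<open>Quotient of a vector space by a subspace\<close>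

text \<open>Scalar multiplication is written as a union over representatives, like \<open>rcoset_mult\<close>;
  multiplying the set \<open>X\<close> elementwise would give the wrong result for the zero scalar.
  The fields \<open>mult\<close> and \<open>one\<close> are placeholders.\<close>

definition quotient_space :: "('a, 'b, 'c) module_scheme \<Rightarrow> 'b set \<Rightarrow> ('a, 'b set) module"
  where "quotient_space V W =
    \<lparr>carrier = a_rcosets\<^bsub>V\<^esub> W, mult = (\<lambda>_ _. W), one = W, zero = W, add = set_add V,
     smult = (\<lambda>c X. \<Union>x\<in>X. W +>\<^bsub>V\<^esub> (c \<odot>\<^bsub>V\<^esub> x))\<rparr>"

section \<open>The characteristic polynomial of a Lie algebra\<close>

text \<open>Polynomials in the indeterminates \<open>z\<^sub>0, z\<^sub>1, \<dots>\<close>: finitely supported maps from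
  monomials (exponent vectors) to coefficients.\<close>

type_synonym 'a multi_poly = "(nat \<Rightarrow>\<^sub>0 nat) \<Rightarrow>\<^sub>0 'a"

definition indet :: "nat \<Rightarrow> 'a::comm_ring_1 multi_poly"
  where "indet i = Poly_Mapping.single (Poly_Mapping.single i 1) 1"

definition scalar :: "'a::comm_ring_1 \<Rightarrow> 'a multi_poly"
  where "scalar c = Poly_Mapping.single 0 c"

definition lie_char_poly ::
    "('a::field, 'b, 'c) lie_algebra_scheme \<Rightarrow> nat \<Rightarrow> (nat \<Rightarrow> 'b) \<Rightarrow> 'a multi_poly"
  where "lie_char_poly L n y =
    det (indet 0 \<cdot>\<^sub>m 1\<^sub>m n +
      mat n n (\<lambda>jm. \<Sum>i = 1..n. indet i *
        scalar (lie_algebra.matrix_of class_ring L n y (lie_algebra.ad L (y i)) $$ jm)))"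

end

theory Submission
  imports Defs
begin

text \<open>
  The algebra is a semidirect product of an abelian algebra \<open>N\<close> of dimension \<open>r\<close> and a torus of dimension
  \<open>k\<close> acting on it diagonally: every \<open>b j\<close> with \<open>j \<ge> 1\<close> is used as the weight of \<open>rs j\<close> basis vectors of \<open>N\<close>,
  and the remaining \<open>rs 0\<close> basis vectors have weight zero. Since the derived algebra lies in \<open>N\<close> and \<open>N\<close> is
  abelian, the algebra is solvable (\<open>metabelian_solvable\<close>).

  Being an abelian ideal, \<open>N\<close> is nilpotent, so it is the nilradical as soon as it contains every nilpotent
  ideal. An element of a nilpotent ideal has no nonzero eigenvalue in the adjoint action
  (\<open>nilpotent_ideal_eigenvector_zero\<close>), so all weights vanish on it. Because the \<open>b j\<close> span, this
  forces its torus part to be zero (\<open>orthogonal_to_spanning_set\<close>), and the element lies in \<open>N\<close>.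

  In the standard basis the generic element of the adjoint representation is upper triangular, with the
  weights and \<open>k\<close> further zeros on its diagonal; the product of the diagonal entries of the
  characteristic matrix is the required polynomial (\<open>char_poly_S\<close>, \<open>prod_blocks\<close>). The codimension of \<open>N\<close> is
  obtained from rank-nullity for the quotient map (\<open>dim_quotient_space\<close>).
\<close>

section \<open>Quotients of vector spaces\<close>

context vectorspace
begin

lemma subspace_imp_abelian_subgroup:
  assumes "subspace K W V"
  shows "abelian_subgroup W V"
proof (rule abelian_subgroupI3)
  interpret W: submodule K W V
    using assms by (rule is_module)
  have "\<ominus>\<^bsub>V\<^esub> x \<in> W" if "x \<in> W" for x
  proof -
    have "\<ominus>\<^bsub>V\<^esub> x = (\<ominus>\<^bsub>K\<^esub> \<one>\<^bsub>K\<^esub>) \<odot>\<^bsub>V\<^esub> x"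
      using that W.subset by (simp add: smult_minus_1 subsetD)
    with that show ?thesis
      by simp
  qed
  moreover have "W \<noteq> {}"
    using W.zero_closed by blast
  ultimately show "additive_subgroup W V"
    using W.subset \<open>W \<noteq> {}\<close> by (intro additive_subgroup.intro add.subgroupI) (auto simp: a_inv_def[symmetric])
  show "abelian_group V" ..
qed

text \<open>The union over representatives collapses to a single coset, since all its members coincide.\<close>

lemma quotient_smult_coset:
  assumes W: "subspace K W V" and c: "c \<in> carrier K" and x: "x \<in> carrier V"
  shows "c \<odot>\<^bsub>quotient_space V W\<^esub> (W +>\<^bsub>V\<^esub> x) = W +>\<^bsub>V\<^esub> (c \<odot>\<^bsub>V\<^esub> x)"
proof -
  interpret W: submodule K W V
    using W by (rule is_module)
  interpret W: abelian_subgroup W V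
    using W by (rule subspace_imp_abelian_subgroup)
  have coset_eq: "W +>\<^bsub>V\<^esub> (c \<odot>\<^bsub>V\<^esub> y) = W +>\<^bsub>V\<^esub> (c \<odot>\<^bsub>V\<^esub> x)" if y: "y \<in> W +>\<^bsub>V\<^esub> x" for y
  proof -
    obtain w where w: "w \<in> W" "y = w \<oplus>\<^bsub>V\<^esub> x"
      using y by (auto simp: a_r_coset_def')
    then have "c \<odot>\<^bsub>V\<^esub> y = c \<odot>\<^bsub>V\<^esub> w \<oplus>\<^bsub>V\<^esub> c \<odot>\<^bsub>V\<^esub> x"
      using c x W.subset by (auto intro: smult_r_distr)
    moreover have "c \<odot>\<^bsub>V\<^esub> w \<in> W"
      using c w by simp
    ultimately have "c \<odot>\<^bsub>V\<^esub> y \<in> W +>\<^bsub>V\<^esub> (c \<odot>\<^bsub>V\<^esub> x)"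
      by (auto simp: a_r_coset_def')
    then show ?thesis
      using c x by (metis W.a_repr_independence' smult_closed)
  qed
  have "(\<Union>y\<in>W +>\<^bsub>V\<^esub> x. W +>\<^bsub>V\<^esub> (c \<odot>\<^bsub>V\<^esub> y)) = (\<Union>y\<in>W +>\<^bsub>V\<^esub> x. W +>\<^bsub>V\<^esub> (c \<odot>\<^bsub>V\<^esub> x))"
    by (rule SUP_cong[OF refl coset_eq])
  also have "\<dots> = W +>\<^bsub>V\<^esub> (c \<odot>\<^bsub>V\<^esub> x)"
    using W.a_rcos_self[OF x] by blast
  finally show ?thesis
    unfolding quotient_space_def by simp
qed

lemma quotient_space_linear_map:
  assumes W: "subspace K W V"
  shows "linear_map K V (quotient_space V W) (\<lambda>x. W +>\<^bsub>V\<^esub> x)"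
proof -
  let ?Q = "quotient_space V W"
  interpret W: abelian_subgroup W V
    using W by (rule subspace_imp_abelian_subgroup)
  have carrier: "carrier ?Q = (\<lambda>x. W +>\<^bsub>V\<^esub> x) ` carrier V"
    unfolding quotient_space_def by (auto simp: A_RCOSETS_def')
  have zero: "\<zero>\<^bsub>?Q\<^esub> = W +>\<^bsub>V\<^esub> \<zero>\<^bsub>V\<^esub>"
    using W.a_subset by (simp add: quotient_space_def)
  have add: "(W +>\<^bsub>V\<^esub> x) \<oplus>\<^bsub>?Q\<^esub> (W +>\<^bsub>V\<^esub> y) = W +>\<^bsub>V\<^esub> (x \<oplus>\<^bsub>V\<^esub> y)"
    if "x \<in> carrier V" "y \<in> carrier V" for x y
    using that by (simp add: quotient_space_def W.a_rcos_sum)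
  note smult = quotient_smult_coset[OF W]
  have module_Q: "module K ?Q"
  proof (rule module_criteria)
    show "cring K" ..
    show "\<forall>X\<in>carrier ?Q. \<exists>Y\<in>carrier ?Q. X \<oplus>\<^bsub>?Q\<^esub> Y = \<zero>\<^bsub>?Q\<^esub>"
    proof
      fix X assume "X \<in> carrier ?Q"
      then obtain x where x: "x \<in> carrier V" "X = W +>\<^bsub>V\<^esub> x"
        unfolding carrier by auto
      then have "X \<oplus>\<^bsub>?Q\<^esub> (W +>\<^bsub>V\<^esub> (\<ominus>\<^bsub>V\<^esub> x)) = \<zero>\<^bsub>?Q\<^esub>"
        by (simp add: add zero M.r_neg)
      with x show "\<exists>Y\<in>carrier ?Q. X \<oplus>\<^bsub>?Q\<^esub> Y = \<zero>\<^bsub>?Q\<^esub>"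
        unfolding carrier by blast
    qed
    show "\<forall>X Y Z. X \<in> carrier ?Q \<and> Y \<in> carrier ?Q \<and> Z \<in> carrier ?Q \<longrightarrow>
        X \<oplus>\<^bsub>?Q\<^esub> Y \<oplus>\<^bsub>?Q\<^esub> Z = X \<oplus>\<^bsub>?Q\<^esub> (Y \<oplus>\<^bsub>?Q\<^esub> Z)"
      unfolding carrier by (auto simp: add M.a_assoc)
    show "\<forall>X Y. X \<in> carrier ?Q \<and> Y \<in> carrier ?Q \<longrightarrow> X \<oplus>\<^bsub>?Q\<^esub> Y = Y \<oplus>\<^bsub>?Q\<^esub> X"
      unfolding carrier by (auto simp: add M.a_comm)
    show "\<forall>X\<in>carrier ?Q. X \<oplus>\<^bsub>?Q\<^esub> \<zero>\<^bsub>?Q\<^esub> = X"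
      unfolding carrier zero by (auto simp: add simp del: a_coset_add_zero)
    show "\<zero>\<^bsub>?Q\<^esub> \<in> carrier ?Q"
      unfolding carrier zero by blast
    show "\<forall>c X. c \<in> carrier K \<and> X \<in> carrier ?Q \<longrightarrow> c \<odot>\<^bsub>?Q\<^esub> X \<in> carrier ?Q"
      unfolding carrier by (auto simp: smult)
    show "\<forall>X Y. X \<in> carrier ?Q \<and> Y \<in> carrier ?Q \<longrightarrow> X \<oplus>\<^bsub>?Q\<^esub> Y \<in> carrier ?Q"
      unfolding carrier by (auto simp: add)
    show "\<forall>X\<in>carrier ?Q. \<one>\<^bsub>K\<^esub> \<odot>\<^bsub>?Q\<^esub> X = X"
      unfolding carrier by (auto simp: smult)
    show "\<forall>a b X. a \<in> carrier K \<and> b \<in> carrier K \<and> X \<in> carrier ?Q \<longrightarrow>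
        (a \<otimes>\<^bsub>K\<^esub> b) \<odot>\<^bsub>?Q\<^esub> X = a \<odot>\<^bsub>?Q\<^esub> (b \<odot>\<^bsub>?Q\<^esub> X)"
      unfolding carrier by (auto simp: smult smult_assoc1)
    show "\<forall>a b X. a \<in> carrier K \<and> b \<in> carrier K \<and> X \<in> carrier ?Q \<longrightarrow>
        (a \<oplus>\<^bsub>K\<^esub> b) \<odot>\<^bsub>?Q\<^esub> X = a \<odot>\<^bsub>?Q\<^esub> X \<oplus>\<^bsub>?Q\<^esub> b \<odot>\<^bsub>?Q\<^esub> X"
      unfolding carrier by (auto simp: smult add smult_l_distr)
    show "\<forall>a X Y. a \<in> carrier K \<and> X \<in> carrier ?Q \<and> Y \<in> carrier ?Q \<longrightarrow>
        a \<odot>\<^bsub>?Q\<^esub> (X \<oplus>\<^bsub>?Q\<^esub> Y) = a \<odot>\<^bsub>?Q\<^esub> X \<oplus>\<^bsub>?Q\<^esub> a \<odot>\<^bsub>?Q\<^esub> Y"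
      unfolding carrier by (auto simp: smult add smult_r_distr)
  qed
  have hom: "(\<lambda>x. W +>\<^bsub>V\<^esub> x) \<in> LinearCombinations.module_hom K V ?Q"
    unfolding LinearCombinations.module_hom_def by (auto simp: carrier add smult)
  have vs: "vectorspace K ?Q"
    using module_Q field_axioms by (rule vectorspace.intro)
  have mh: "mod_hom K V ?Q (\<lambda>x. W +>\<^bsub>V\<^esub> x)"
    using module_axioms module_Q mod_hom_axioms.intro[OF hom] by (rule mod_hom.intro)
  show ?thesis
    using vectorspace_axioms vs mh by (rule linear_map.intro)
qed

text \<open>Rank-nullity for the projection onto the quotient, whose kernel is the subspace.\<close>

lemma dim_quotient_space:
  assumes W: "subspace K W V" and "fin_dim"
  shows "vectorspace.dim K (quotient_space V W) + vectorspace.dim K (V\<lparr>carrier := W\<rparr>) = dim"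
proof -
  interpret W: abelian_subgroup W V
    using W by (rule subspace_imp_abelian_subgroup)
  interpret T: linear_map K V "quotient_space V W" "\<lambda>x. W +>\<^bsub>V\<^esub> x"
    using W by (rule quotient_space_linear_map)
  have "T.im = carrier (quotient_space V W)"
    unfolding T.im_def by (auto simp: quotient_space_def A_RCOSETS_def')
  moreover have "T.ker = W"
  proof
    show "T.ker \<subseteq> W"
      unfolding T.ker_def using W.a_rcos_self by (auto simp: quotient_space_def)
    show "W \<subseteq> T.ker"
      unfolding T.ker_def using W.a_rcos_const W.a_subset by (auto simp: quotient_space_def)
  qed
  ultimately show ?thesis
    using T.rank_nullity[OF \<open>fin_dim\<close>] by simp
qed

end

section \<open>Nilpotent ideals and solvability\<close>

context lie_algebra
begin

lemma zero_submodule: "submodule K {\<zero>} L"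
  by (rule submodule.intro) (use module_axioms in auto)

lemma bracket_anticommute:
  assumes x: "x \<in> carrier L" and y: "y \<in> carrier L"
  shows "\<lblot>y, x\<rblot> = (\<ominus>\<^bsub>K\<^esub> \<one>\<^bsub>K\<^esub>) \<odot> \<lblot>x, y\<rblot>"
proof -
  have "\<zero> = \<lblot>x \<oplus> y, x \<oplus> y\<rblot>"
    using x y by (simp add: bracket_self)
  also have "\<dots> = \<lblot>x, y\<rblot> \<oplus> \<lblot>y, x\<rblot>"
    using x y by (simp add: bracket_add_left bracket_add_right bracket_closed M.a_comm bracket_self[OF x] bracket_self[OF y])
  finally have "\<lblot>y, x\<rblot> = \<ominus> \<lblot>x, y\<rblot>"
    using x y by (intro M.minus_equality[symmetric]) (auto simp: M.a_comm bracket_closed)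
  then show ?thesis
    using x y by (simp add: smult_minus_1 bracket_closed)
qed

lemma bracket_span_commuting:
  assumes "\<And>x y. x \<in> A \<Longrightarrow> y \<in> B \<Longrightarrow> \<lblot>x, y\<rblot> = \<zero>"
  shows "bracket_span A B = {\<zero>}"
proof
  show "bracket_span A B \<subseteq> {\<zero>}"
    unfolding bracket_span_def using assms by (intro span_is_subset zero_submodule) auto
  show "{\<zero>} \<subseteq> bracket_span A B"
    unfolding bracket_span_def by (simp add: span_zero)
qed

lemma abelian_ideal_nilpotent:
  assumes "lie_ideal A" and "abelian_on A"
  shows "nilpotent_ideal A"
proof -
  have "lower_central_series A (Suc 0) = {\<zero>}"
    using \<open>abelian_on A\<close> by (simp add: abelian_on_def bracket_span_commuting)
  with \<open>lie_ideal A\<close> show ?thesis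
    unfolding nilpotent_ideal_def by blast
qed

lemma metabelian_solvable:
  assumes "abelian_on A" and "subspace K A L"
    and brackets: "\<And>x y. x \<in> carrier L \<Longrightarrow> y \<in> carrier L \<Longrightarrow> \<lblot>x, y\<rblot> \<in> A"
  shows solvable
proof -
  have "derived_series (Suc 0) \<subseteq> A"
    unfolding derived_series.simps bracket_span_def
    using brackets \<open>subspace K A L\<close> by (intro span_is_subset) auto
  with \<open>abelian_on A\<close> have "derived_series (Suc (Suc 0)) = {\<zero>}"
    unfolding derived_series.simps(2)[of "Suc 0"] abelian_on_def
    by (intro bracket_span_commuting) blast
  then show ?thesis
    unfolding solvable_def by blast
qed

lemma lower_central_series_subset:
  assumes "lie_ideal I"
  shows "lower_central_series I n \<subseteq> I"
proof (induction n)
  case (Suc n)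
  have I: "submodule K I L" and ideal: "\<And>x y. x \<in> carrier L \<Longrightarrow> y \<in> I \<Longrightarrow> \<lblot>x, y\<rblot> \<in> I"
    using assms by (auto simp: lie_ideal_def)
  have "{\<lblot>x, y\<rblot> | x y. x \<in> I \<and> y \<in> lower_central_series I n} \<subseteq> I"
    using Suc ideal submodule.subset[OF I] by blast
  then show ?case
    using I by (simp add: bracket_span_def span_is_subset)
qed simp

text \<open>An element \<open>x\<close> of a nilpotent ideal acts nilpotently on the whole algebra, so zero is its only
  eigenvalue. Concretely, an eigenvector for \<open>c \<noteq> 0\<close> is a multiple of \<open>[x, v]\<close>; it therefore lies in the ideal and then,
  bracketing with \<open>x\<close> again and again, in every term of the lower central series.\<close>

lemma nilpotent_ideal_eigenvector_zero:
  assumes M: "nilpotent_ideal M" and x: "x \<in> M" and v: "v \<in> carrier L"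
    and c: "c \<in> carrier K" "c \<noteq> \<zero>\<^bsub>K\<^esub>" and eigen: "\<lblot>x, v\<rblot> = c \<odot> v"
  shows "v = \<zero>"
proof -
  have sub: "submodule K M L" and ideal: "\<And>y z. y \<in> carrier L \<Longrightarrow> z \<in> M \<Longrightarrow> \<lblot>y, z\<rblot> \<in> M"
    using M by (auto simp: nilpotent_ideal_def lie_ideal_def)
  then have M_sub: "M \<subseteq> carrier L"
    by (simp add: submodule.subset)
  have inv_c: "inv\<^bsub>K\<^esub> c \<in> carrier K" "inv\<^bsub>K\<^esub> c \<otimes>\<^bsub>K\<^esub> c = \<one>\<^bsub>K\<^esub>"
    using c by (auto simp: field_Units)
  then have v_eq: "inv\<^bsub>K\<^esub> c \<odot> \<lblot>x, v\<rblot> = v"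
    using c v by (simp add: eigen smult_assoc1[symmetric])
  have "v \<in> lower_central_series M n" for n
  proof (induction n)
    case 0
    have "\<lblot>x, v\<rblot> = (\<ominus>\<^bsub>K\<^esub> \<one>\<^bsub>K\<^esub>) \<odot> \<lblot>v, x\<rblot>"
      using bracket_anticommute[of v x] v x M_sub by auto
    then have "\<lblot>x, v\<rblot> \<in> M"
      using ideal[OF v x] submodule.smult_closed[OF sub] by simp
    then show ?case
      using submodule.smult_closed[OF sub inv_c(1)] by (metis v_eq lower_central_series.simps(1))
  next
    case (Suc n)
    let ?B = "{\<lblot>y, z\<rblot> | y z. y \<in> M \<and> z \<in> lower_central_series M n}"
    have B: "?B \<subseteq> carrier L"
      using M_sub lower_central_series_subset[of M n] M
      by (auto simp: nilpotent_ideal_def intro!: bracket_closed)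
    then have "\<lblot>x, v\<rblot> \<in> span ?B"
      using in_own_span x Suc by blast
    then have "inv\<^bsub>K\<^esub> c \<odot> \<lblot>x, v\<rblot> \<in> span ?B"
      using span_is_submodule[OF B] inv_c(1) by (simp add: submodule.smult_closed)
    then show ?case
      by (simp add: v_eq bracket_span_def)
  qed
  then show ?thesis
    using M unfolding nilpotent_ideal_def by blast
qed

lemma abelian_ideal_is_nilradical:
  assumes "lie_ideal A" and "abelian_on A"
    and max: "\<And>M. nilpotent_ideal M \<Longrightarrow> M \<subseteq> A"
  shows "is_nilradical A"
proof -
  have A: "nilpotent_ideal A"
    using assms(1,2) by (rule abelian_ideal_nilpotent)
  with max have "maximal A nilpotent_ideal"
    unfolding maximal_def by (simp add: subset_antisym)
  moreover have "M = A" if "maximal M nilpotent_ideal" for M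
    using that A max[of M] unfolding maximal_def by metis
  ultimately show ?thesis
    unfolding is_nilradical_def by blast
qed

end

section \<open>A torus acting diagonally on an abelian algebra\<close>

lemma (in vec_space) lincomb_unit_vecs_index:
  assumes "m \<le> n" and i: "i < n"
  shows "lincomb a (unit_vec n ` {..<m}) $ i = (if i < m then a (unit_vec n i) else 0)"
proof -
  have inj: "inj_on (unit_vec n :: nat \<Rightarrow> 'a vec) {..<m}"
    using \<open>m \<le> n\<close> by (intro inj_onI) (simp add: unit_vec_eq)
  have "(unit_vec n ` {..<m} :: 'a vec set) \<subseteq> carrier_vec n"
    by auto
  then have "lincomb a (unit_vec n ` {..<m}) $ i = (\<Sum>j<m. a (unit_vec n j) * unit_vec n j $ i)"
    by (simp add: lincomb_index[OF i] sum.reindex[OF inj])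
  also have "\<dots> = (\<Sum>j<m. if j = i then a (unit_vec n i) else 0)"
    using \<open>m \<le> n\<close> i by (intro sum.cong) auto
  finally show ?thesis
    by (simp add: sum.delta)
qed

text \<open>The algebra is the coordinate space of dimension \<open>r + k\<close>, split as the first \<open>r\<close> coordinates (the
  future nilradical) and the last \<open>k\<close> (the torus). The torus acts on the \<open>i\<close>-th of the first \<open>r\<close> basis
  vectors by the linear form with coefficients \<open>w i 0, \<dots>, w i (k - 1)\<close>. Extending that form by zero to the
  whole space lets the semidirect bracket be written as one antisymmetric formula.\<close>

locale weight_algebra =
  fixes r k :: nat and w :: "nat \<Rightarrow> nat \<Rightarrow> 'a :: field"
begin

abbreviation n :: nat where "n \<equiv> r + k"

definition weight :: "nat \<Rightarrow> 'a vec \<Rightarrow> 'a"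
  where "weight i x = (\<Sum>\<alpha><k. w i \<alpha> * x $ (r + \<alpha>))"

definition S :: "('a, 'a vec) lie_algebra"
  where "S = module.extend (module_vec TYPE('a) n)
    \<lparr>bracket = \<lambda>x y. vec n (\<lambda>i. if i < r then weight i x * y $ i - weight i y * x $ i else 0)\<rparr>"

definition N :: "'a vec set"
  where "N = {x \<in> carrier_vec n. \<forall>i<n. r \<le> i \<longrightarrow> x $ i = 0}"

lemma S_simps [simp]:
  "carrier S = carrier_vec n"
  "zero S = 0\<^sub>v n"
  "add S = (+)"
  "smult S = (\<cdot>\<^sub>v)"
  by (simp_all add: S_def module.defs module_vec_simps)

lemma bracket_S: "bracket S x y = vec n (\<lambda>i. if i < r then weight i x * y $ i - weight i y * x $ i else 0)"
  by (simp add: S_def module.defs)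

lemma bracket_S_index:
  "i < n \<Longrightarrow> bracket S x y $ i = (if i < r then weight i x * y $ i - weight i y * x $ i else 0)"
  by (simp add: bracket_S)

lemma bracket_S_carrier [simp]: "bracket S x y \<in> carrier_vec n"
  by (simp add: bracket_S)

lemma weight_add:
  assumes "x \<in> carrier_vec n" "y \<in> carrier_vec n"
  shows "weight i (x + y) = weight i x + weight i y"
  using assms by (simp add: weight_def algebra_simps sum.distrib)

lemma weight_smult:
  assumes "x \<in> carrier_vec n"
  shows "weight i (c \<cdot>\<^sub>v x) = c * weight i x"
  using assms by (simp add: weight_def sum_distrib_left algebra_simps)

lemma weight_N:
  assumes "x \<in> N"
  shows "weight i x = 0"
  using assms by (simp add: weight_def N_def)

lemma weight_unit_vec:
  assumes "m < n"
  shows "weight i (unit_vec n m) = (if r \<le> m then w i (m - r) else 0)"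
proof -
  have "weight i (unit_vec n m) = (\<Sum>\<alpha><k. if \<alpha> = m - r then (if r \<le> m then w i (m - r) else 0) else 0)"
    unfolding weight_def using assms by (intro sum.cong) auto
  with assms show ?thesis
    by (auto simp: sum.delta)
qed

lemma bracket_S_in_N [simp]: "bracket S x y \<in> N"
  by (auto simp: N_def bracket_S)

lemma vectorspace_S: "vectorspace class_ring S"
proof (rule vectorspace.intro)
  show "module class_ring S"
  proof (rule module_criteria)
    show "cring (class_ring :: 'a ring)" ..
    show "\<forall>v\<in>carrier S. \<exists>u\<in>carrier S. v \<oplus>\<^bsub>S\<^esub> u = \<zero>\<^bsub>S\<^esub>"
      by (auto intro!: bexI[of _ "- _"])
  qed (auto simp: smult_add_distrib_vec add_smult_distrib_vec comm_add_vec smult_smult_assoc)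
  show "field (class_ring :: 'a ring)"
    by (rule class_field)
qed

text \<open>The weights see only the last \<open>k\<close> coordinates, while a bracket has nonzero entries only among the first \<open>r\<close>. So a weight of a
  bracket vanishes, and in the Jacobi identity just the products of two weights with one coordinate
  remain, which cancel cyclically.\<close>

lemma lie_algebra_S: "lie_algebra class_ring S"
proof (intro lie_algebra.intro lie_algebra_axioms.intro vectorspace_S)
  fix x y z assume "x \<in> carrier S" "y \<in> carrier S" "z \<in> carrier S"
  then show "bracket S (x \<oplus>\<^bsub>S\<^esub> y) z = bracket S x z \<oplus>\<^bsub>S\<^esub> bracket S y z"
    and "bracket S x (y \<oplus>\<^bsub>S\<^esub> z) = bracket S x y \<oplus>\<^bsub>S\<^esub> bracket S x z"
    and "bracket S x (bracket S y z) \<oplus>\<^bsub>S\<^esub> bracket S y (bracket S z x) \<oplus>\<^bsub>S\<^esub> bracket S z (bracket S x y)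
      = \<zero>\<^bsub>S\<^esub>"
    by (auto intro!: eq_vecI
        simp: bracket_S_index weight_N weight_add bracket_S[THEN arg_cong[of _ _ dim_vec]] algebra_simps)
next
  fix c x y assume "c \<in> carrier (class_ring :: 'a ring)" "x \<in> carrier S" "y \<in> carrier S"
  then show "bracket S (c \<odot>\<^bsub>S\<^esub> x) y = c \<odot>\<^bsub>S\<^esub> bracket S x y"
    and "bracket S x (c \<odot>\<^bsub>S\<^esub> y) = c \<odot>\<^bsub>S\<^esub> bracket S x y"
    by (auto intro!: eq_vecI simp: bracket_S weight_smult algebra_simps)
qed (auto intro!: eq_vecI simp: bracket_S)

sublocale S: lie_algebra class_ring S
  by (rule lie_algebra_S)

lemma submodule_N: "submodule class_ring N S"
  by (rule submodule.intro) (auto simp: N_def S.module_axioms)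

lemma subspace_N: "subspace class_ring N S"
  by (rule subspace.intro[OF S.vectorspace_axioms submodule_N])

lemma abelian_N: "S.abelian_on N"
  by (auto simp: S.abelian_on_def bracket_S weight_N intro!: eq_vecI)

lemma ideal_N: "S.lie_ideal N"
  by (simp add: S.lie_ideal_def subspace_N)

lemma solvable_S: "S.solvable"
  by (rule S.metabelian_solvable[OF abelian_N subspace_N]) simp

lemma bracket_unit_vec:
  assumes "i < r" and "x \<in> carrier_vec n"
  shows "bracket S x (unit_vec n i) = weight i x \<cdot>\<^sub>v unit_vec n i"
  using assms by (intro eq_vecI) (auto simp: bracket_S weight_unit_vec)

text \<open>Faithfulness of the torus action is what makes \<open>N\<close> contain every nilpotent ideal: an element
  outside \<open>N\<close> has some nonzero weight, hence acts on a unit vector with a nonzero eigenvalue, which no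
  element of a nilpotent ideal can do.\<close>

lemma nilradical_N:
  assumes faithful: "\<And>x. x \<in> carrier_vec n \<Longrightarrow> (\<And>i. i < r \<Longrightarrow> weight i x = 0) \<Longrightarrow> x \<in> N"
  shows "S.is_nilradical N"
proof (rule S.abelian_ideal_is_nilradical[OF ideal_N abelian_N])
  fix M assume M: "S.nilpotent_ideal M"
  then have "submodule class_ring M S"
    by (simp add: S.nilpotent_ideal_def S.lie_ideal_def)
  then have "M \<subseteq> carrier_vec n"
    using submodule.subset by fastforce
  show "M \<subseteq> N"
  proof
    fix x assume x: "x \<in> M"
    with \<open>M \<subseteq> carrier_vec n\<close> have x_carrier: "x \<in> carrier_vec n"
      by blast
    have "weight i x = 0" if "i < r" for i
    proof (rule ccontr)
      assume "weight i x \<noteq> 0"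
      then have "(unit_vec n i :: 'a vec) = 0\<^sub>v n"
        using S.nilpotent_ideal_eigenvector_zero[OF M x, of "unit_vec n i" "weight i x"]
        by (simp add: bracket_unit_vec[OF that x_carrier])
      from arg_cong[OF this, of "\<lambda>v. v $ i"] that show False
        by simp
    qed
    with x_carrier show "x \<in> N"
      by (rule faithful)
  qed
qed

sublocale vec: vec_space "TYPE('a)" n .

lemma lincomb_S: "S.lincomb a A = vec.lincomb a A"
  by (simp add: S.lincomb_def vec.lincomb_def finsum_def finprod_def)

lemma lincomb_unit_vecs_S_index:
  assumes "m \<le> n" and "i < n"
  shows "S.lincomb a (unit_vec n ` {..<m}) $ i = (if i < m then a (unit_vec n i) else 0)"
  unfolding lincomb_S using assms by (rule vec.lincomb_unit_vecs_index)

lemma lincomb_unit_vecs_S_carrier: "S.lincomb a (unit_vec n ` {..<m}) \<in> carrier_vec n"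
  using S.lincomb_closed[of "unit_vec n ` {..<m}" a] by (simp add: image_subset_iff)

lemma lincomb_unit_vecs_S_dim [simp]: "dim_vec (S.lincomb a (unit_vec n ` {..<m})) = n"
  by (rule carrier_vecD[OF lincomb_unit_vecs_S_carrier])

text \<open>Existence and uniqueness of coordinates in one equivalence: it yields both the basis property and the
  value of the definite description in \<open>coords\<close>.\<close>

lemma unit_vecs_expansion:
  assumes v: "v \<in> carrier_vec n"
  shows "a \<in> unit_vec n ` {..<n} \<rightarrow>\<^sub>E UNIV \<and> S.lincomb a (unit_vec n ` {..<n}) = v
    \<longleftrightarrow> a = (\<lambda>u\<in>unit_vec n ` {..<n}. v \<bullet> u)"
proof -
  let ?Y = "unit_vec n ` {..<n} :: 'a vec set"
  have "S.lincomb a ?Y = v \<longleftrightarrow> (\<forall>i<n. S.lincomb a ?Y $ i = v $ i)"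
    using v by (auto simp: vec_eq_iff)
  also have "\<dots> \<longleftrightarrow> (\<forall>u\<in>?Y. a u = v \<bullet> u)"
    using v by (auto simp: lincomb_unit_vecs_S_index)
  finally show ?thesis
    by (auto simp: PiE_UNIV_domain fun_eq_iff PiE_def extensional_def)
qed

lemma basis_S: "S.basis (unit_vec n ` {..<n})"
  by (subst S.basis_criterion) (auto simp: unit_vecs_expansion)

lemma coords_S:
  assumes "v \<in> carrier_vec n" and "i < n"
  shows "S.coords (unit_vec n ` {..<n}) v (unit_vec n i) = v $ i"
  using assms by (simp add: S.coords_def unit_vecs_expansion)

lemma basis_N: "vectorspace.basis class_ring (S\<lparr>carrier := N\<rparr>) (unit_vec n ` {..<r})"
proof -
  let ?X = "unit_vec n ` {..<r} :: 'a vec set"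
  interpret N: vectorspace class_ring "S\<lparr>carrier := N\<rparr>"
    using subspace_N by (rule S.subspace_is_vs)
  have X: "?X \<subseteq> N"
    by (auto simp: N_def)
  have "N \<subseteq> S.span ?X"
  proof
    fix v assume v: "v \<in> N"
    have "v = S.lincomb (\<lambda>u. v \<bullet> u) ?X"
      using v by (intro eq_vecI) (auto simp: N_def lincomb_unit_vecs_S_index)
    moreover have "S.lincomb (\<lambda>u. v \<bullet> u) ?X \<in> S.span ?X"
      unfolding S.span_def by (rule CollectI) auto
    ultimately show "v \<in> S.span ?X"
      by simp
  qed
  moreover have "S.span ?X \<subseteq> N"
    using X submodule_N by (rule S.span_is_subset)
  ultimately have "S.span ?X = N"
    by (rule equalityI[rotated])
  moreover have "\<not> S.lin_dep ?X"
    by (rule S.subset_li_is_li[of "unit_vec n ` {..<n}"]) (use basis_S in \<open>auto simp: S.basis_def\<close>)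
  ultimately show ?thesis
    unfolding N.basis_def using X S.span_li_not_depend[OF X submodule_N] by simp
qed

lemma card_unit_vecs:
  assumes "m \<le> n"
  shows "card (unit_vec n ` {..<m} :: 'a vec set) = m"
proof -
  have "inj_on (unit_vec n :: nat \<Rightarrow> 'a vec) {..<m}"
    using assms by (intro inj_onI) (simp add: unit_vec_eq)
  then show ?thesis
    by (simp add: card_image)
qed

lemma dim_N: "vectorspace.dim class_ring (S\<lparr>carrier := N\<rparr>) = r"
  using vectorspace.dim_basis[OF S.subspace_is_vs[OF subspace_N] _ basis_N]
  by (simp add: card_unit_vecs)

lemma dim_quotient_N: "vectorspace.dim class_ring (quotient_space S N) = k"
proof -
  have "S.dim = n"
    using S.dim_basis[OF _ basis_S] by (simp add: card_unit_vecs)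
  moreover have "S.fin_dim"
    unfolding S.fin_dim_def using basis_S by (intro exI[of _ "unit_vec n ` {..<n}"]) (simp add: S.basis_def)
  ultimately show ?thesis
    using S.dim_quotient_space[OF subspace_N] by (simp add: dim_N)
qed

definition std_basis :: "nat \<Rightarrow> 'a vec"
  where "std_basis m = unit_vec n (m - 1)"

lemma std_basis_image: "std_basis ` {1..m} = unit_vec n ` {..<m}"
proof -
  have "{..<m} = (\<lambda>m. m - 1) ` {1..m}"
    by (auto simp: image_iff intro!: bexI[of _ "Suc _"])
  then show ?thesis
    by (simp add: std_basis_def image_image)
qed

lemma inj_std_basis: "inj_on std_basis {1..n}"
  by (intro inj_onI) (auto simp: std_basis_def unit_vec_eq)

lemma ad_matrix_entry:
  assumes "l \<in> {1..n}" and "i < n" and "j < n"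
  shows "S.matrix_of n std_basis (S.ad (std_basis l)) $$ (i, j) =
    (if i < r then (if i = j then weight i (std_basis l) else 0) -
      (if l = Suc i then weight i (unit_vec n j) else 0) else 0)"
proof -
  have "S.matrix_of n std_basis (S.ad (std_basis l)) $$ (i, j) = bracket S (std_basis l) (unit_vec n j) $ i"
    unfolding S.matrix_of_def std_basis_image using assms by (simp add: S.ad_def std_basis_def coords_S)
  moreover have "std_basis l $ i = (if l = Suc i then 1 else 0)"
    using assms by (auto simp: std_basis_def)
  ultimately show ?thesis
    using assms by (simp add: bracket_S_index)
qed

text \<open>In the standard basis, the torus acts by diagonal matrices, while the elements of \<open>N\<close> map the torus into
  \<open>N\<close> and kill \<open>N\<close>. With \<open>N\<close> listed first, every matrix in the pencil is therefore upper triangular, and the elements of \<open>N\<close> leave no trace on the diagonal.\<close>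

lemma char_poly_S:
  "lie_char_poly S n std_basis = indet 0 ^ k *
    (\<Prod>i<r. indet 0 + (\<Sum>\<alpha>=1..k. scalar (w i (\<alpha> - 1)) * indet (r + \<alpha>)))"
proof -
  define A where "A = indet 0 \<cdot>\<^sub>m 1\<^sub>m n +
    mat n n (\<lambda>jm. \<Sum>i = 1..n. indet i * scalar (S.matrix_of n std_basis (S.ad (std_basis i)) $$ jm))"
  have scalar_0: "scalar 0 = 0"
    by (simp add: scalar_def)
  have A: "A \<in> carrier_mat n n"
    by (simp add: A_def)
  have "A $$ (i, j) = 0" if "j < i" "i < n" for i j
  proof -
    have "S.matrix_of n std_basis (S.ad (std_basis l)) $$ (i, j) = 0" if "l \<in> {1..n}" for l
      using \<open>j < i\<close> \<open>i < n\<close> that by (simp add: ad_matrix_entry weight_unit_vec)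
    then show ?thesis
      using that by (simp add: A_def scalar_0)
  qed
  then have "upper_triangular A"
    using A by auto
  then have det_A: "det A = (\<Prod>i<n. A $$ (i, i))"
    using A by (simp add: det_upper_triangular[OF _ A] diag_mat_def prod.list_conv_set_nth atLeast0LessThan)
  have below: "A $$ (i, i) = indet 0" if "r \<le> i" "i < n" for i
    using that by (simp add: A_def ad_matrix_entry scalar_0)
  have above: "A $$ (i, i) = indet 0 + (\<Sum>\<alpha>=1..k. scalar (w i (\<alpha> - 1)) * indet (r + \<alpha>))"
    if "i < r" for i
  proof -
    have torus_weight: "weight i (std_basis (\<alpha> + r)) = w i (\<alpha> - 1)" if "\<alpha> \<in> {1..k}" for \<alpha>
    proof -
      from that obtain \<beta> where "\<alpha> = Suc \<beta>" "\<beta> < k"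
        by (cases \<alpha>) auto
      then show ?thesis
        by (simp add: std_basis_def weight_unit_vec)
    qed
    have "S.matrix_of n std_basis (S.ad (std_basis l)) $$ (i, i) = weight i (std_basis l)" if "l \<in> {1..n}" for l
      using \<open>i < r\<close> that by (simp add: ad_matrix_entry weight_unit_vec)
    then have "A $$ (i, i) = indet 0 + (\<Sum>l=1..n. indet l * scalar (weight i (std_basis l)))"
      using that by (simp add: A_def)
    \<comment> \<open>The first \<open>r\<close> basis vectors lie in \<open>N\<close>, where all weights vanish.\<close>
    also have "(\<Sum>l=1..n. indet l * scalar (weight i (std_basis l))) =
      (\<Sum>l=1+r..k+r. indet l * scalar (weight i (std_basis l)))"
      by (rule sum.mono_neutral_right) (auto simp: std_basis_def weight_unit_vec scalar_0 split: if_splits)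
    also have "\<dots> = (\<Sum>\<alpha>=1..k. scalar (w i (\<alpha> - 1)) * indet (r + \<alpha>))"
      unfolding sum.shift_bounds_cl_nat_ivl
      by (intro sum.cong refl) (simp add: torus_weight add.commute[of r] mult.commute)
    finally show ?thesis .
  qed
  have "{..<n} = {..<r} \<union> {r..<n}"
    by auto
  then have "det A = (\<Prod>i\<in>{..<r} \<union> {r..<n}. A $$ (i, i))"
    using det_A by simp
  also have "\<dots> = (\<Prod>i<r. A $$ (i, i)) * (\<Prod>i=r..<n. A $$ (i, i))"
    by (rule prod.union_disjoint) auto
  also have "(\<Prod>i=r..<n. A $$ (i, i)) = indet 0 ^ k"
    using below by simp
  also have "(\<Prod>i<r. A $$ (i, i)) =
    (\<Prod>i<r. indet 0 + (\<Sum>\<alpha>=1..k. scalar (w i (\<alpha> - 1)) * indet (r + \<alpha>)))"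
    using above by simp
  finally show ?thesis
    by (simp add: lie_char_poly_def A_def mult.commute)
qed

end

section \<open>Prescribing the weights and their multiplicities\<close>

text \<open>The list that distributes the weights over the basis of the nilradical: its \<open>i\<close>-th entry (counted from
  0) says which weight the \<open>i\<close>-th basis vector receives.\<close>

definition blocks :: "(nat \<Rightarrow> nat) \<Rightarrow> nat \<Rightarrow> nat list"
  where "blocks m p = concat (map (\<lambda>j. replicate (m j) j) [0..<Suc p])"

lemma blocks_Suc: "blocks m (Suc p) = blocks m p @ replicate (m (Suc p)) (Suc p)"
  by (simp add: blocks_def)

lemma length_blocks: "length (blocks m p) = (\<Sum>j=0..p. m j)"
  by (induction p) (simp_all add: blocks_def)

lemma set_blocks: "set (blocks m p) = {j. j \<le> p \<and> m j > 0}"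
  by (auto simp: blocks_def less_Suc_eq_le simp del: upt_Suc)

lemma prod_blocks:
  fixes f :: "nat \<Rightarrow> 'a :: comm_monoid_mult"
  shows "(\<Prod>i<length (blocks m p). f (blocks m p ! i)) = (\<Prod>j=0..p. f j ^ m j)"
proof -
  have "prod_list (map f (blocks m p)) = (\<Prod>j=0..p. f j ^ m j)"
    by (induction p) (simp_all add: blocks_Suc, simp add: blocks_def)
  then show ?thesis
    by (simp add: prod.list_conv_set_nth atLeast0LessThan)
qed

lemma orthogonal_to_spanning_set:
  fixes x :: "'a :: field vec"
  assumes "B \<subseteq> carrier_vec k"
    and span: "LinearCombinations.module.span class_ring (module_vec TYPE('a) k) B = carrier_vec k"
    and x: "x \<in> carrier_vec k" and orth: "\<And>b. b \<in> B \<Longrightarrow> x \<bullet> b = 0"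
  shows "x = 0\<^sub>v k"
proof -
  interpret V: vec_space "TYPE('a)" k .
  have "x \<in> V.orthogonal_complement B"
    using x orth by (simp add: V.orthogonal_complement_def)
  then have "x \<in> V.orthogonal_complement (V.span B)"
    using assms(1) by simp
  then have "x \<bullet> unit_vec k i = 0" if "i < k" for i
    unfolding span V.orthogonal_complement_def by simp
  with x show ?thesis
    by (intro eq_vecI) auto
qed

text \<open>Index 0 stands for the zero weight and is kept apart from \<open>b 0\<close>, which is arbitrary. A vector killed
  by all weights has its torus part orthogonal to the spanning set, so it lies in \<open>N\<close>; here each \<open>b j\<close> with
  \<open>j \<ge> 1\<close> must really occur as a weight, which is the positivity of its multiplicity.\<close>

theorem proposition5p5:
  fixes k p r :: nat
    and B :: "complex vec set"
    and b :: "nat \<Rightarrow> complex vec"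
    and rs :: "nat \<Rightarrow> nat"
  assumes "B = b ` {1..p}"
    and "B \<subseteq> carrier_vec k - {0\<^sub>v k}"
    and "LinearCombinations.module.span class_ring (module_vec TYPE(complex) k) B = carrier_vec k"
    and "\<forall>j\<in>{1..p}. rs j > 0"
    and "r = (\<Sum>j = 0..p. rs j)"
  shows "\<exists>(S :: (complex, complex vec) lie_algebra) N y.
    lie_algebra class_ring S \<and>
    lie_algebra.solvable class_ring S \<and>
    lie_algebra.is_nilradical class_ring S N \<and>
    lie_algebra.abelian_on S N \<and>
    vectorspace.dim class_ring (S\<lparr>carrier := N\<rparr>) = r \<and>
    vectorspace.dim class_ring (quotient_space S N) = k \<and>
    inj_on y {1..r + k} \<and>
    vectorspace.basis class_ring S (y ` {1..r + k}) \<and>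
    vectorspace.basis class_ring (S\<lparr>carrier := N\<rparr>) (y ` {1..r}) \<and>
    lie_char_poly S (r + k) y =
      indet 0 ^ (k + rs 0) *
      (\<Prod>i = 1..p. (indet 0 + (\<Sum>\<alpha> = 1..k. scalar (b i $ (\<alpha> - 1)) * indet (r + \<alpha>))) ^ rs i)"
proof -
  define j where "j i = blocks rs p ! i" for i
  define w where "w i \<alpha> = (if j i = 0 then 0 else b (j i) $ \<alpha>)" for i \<alpha>
  have r: "r = length (blocks rs p)"
    using assms(5) by (simp add: length_blocks)
  have B: "B \<subseteq> carrier_vec k"
    using assms(2) by blast
  interpret A: weight_algebra r k w .
  have "A.S.is_nilradical A.N"
  proof (rule A.nilradical_N)
    fix x assume x: "x \<in> carrier_vec (r + k)" and weights: "\<And>i. i < r \<Longrightarrow> A.weight i x = 0"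
    \<comment> \<open>The torus part of \<open>x\<close>.\<close>
    define x' where "x' = vec k (\<lambda>\<alpha>. x $ (r + \<alpha>))"
    have "x' = 0\<^sub>v k"
    proof (rule orthogonal_to_spanning_set[OF B assms(3)])
      show "x' \<in> carrier_vec k"
        by (simp add: x'_def)
      fix c assume "c \<in> B"
      then obtain l where l: "l \<in> {1..p}" "c = b l"
        using assms(1) by blast
      then have "l \<in> set (blocks rs p)"
        using assms(4) by (simp add: set_blocks)
      then obtain i where i: "i < r" "j i = l"
        by (auto simp: in_set_conv_nth r j_def)
      have "x' \<bullet> c = A.weight i x"
        using B \<open>c \<in> B\<close> l i
        by (auto simp: scalar_prod_def x'_def A.weight_def w_def atLeast0LessThan mult.commute)
      with weights i show "x' \<bullet> c = 0"
        by simp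
    qed
    then have "x $ (r + \<alpha>) = 0" if "\<alpha> < k" for \<alpha>
      using that by (metis x'_def index_vec index_zero_vec(1))
    with x show "x \<in> A.N"
      by (auto simp: A.N_def le_iff_add)
  qed
  moreover have "lie_char_poly A.S (r + k) A.std_basis =
    indet 0 ^ (k + rs 0) *
    (\<Prod>i = 1..p. (indet 0 + (\<Sum>\<alpha> = 1..k. scalar (b i $ (\<alpha> - 1)) * indet (r + \<alpha>))) ^ rs i)"
  proof -
    define f where "f l = indet 0 + (\<Sum>\<alpha>=1..k. scalar (if l = 0 then 0 else b l $ (\<alpha> - 1)) * indet (r + \<alpha>))" for l
    have "lie_char_poly A.S (r + k) A.std_basis = indet 0 ^ k * (\<Prod>i<r. f (j i))"
      unfolding A.char_poly_S f_def w_def ..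
    also have "(\<Prod>i<r. f (j i)) = (\<Prod>l=0..p. f l ^ rs l)"
      unfolding r j_def by (rule prod_blocks)
    also have "\<dots> = indet 0 ^ rs 0 * (\<Prod>l=1..p. f l ^ rs l)"
      by (simp add: prod.atLeast_Suc_atMost f_def scalar_def)
    finally show ?thesis
      by (simp add: power_add mult.assoc f_def)
  qed
  ultimately show ?thesis
    using A.S.lie_algebra_axioms A.solvable_S A.abelian_N A.dim_N A.dim_quotient_N A.inj_std_basis
      A.basis_S[folded A.std_basis_image] A.basis_N[folded A.std_basis_image]
    by blast
qed

end
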